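(* Let $d\geq 1$, $p>1$ and $m>0$, and let $f,g$ be real trigonometric polynomials on $\mathbb{T}^d=\mathbb{R}^d/(2\pi\mathbb{Z})^d$ with $g\not\equiv 0$. For $\nu=(\nu_1,\dots,\nu_d)\in[1,2]^d$ and $\epsilon\geq 0$ consider the equation $$-\Delta_\nu u-mu+\epsilon\big(f(x)u^p+g(x)\big)=0,\qquad x\in\mathbb{T}^d,\qquad (\ast)$$ where $\Delta_\nu:=-\sum_{i=1}^d\nu_i^2\frac{\partial^2}{\partial x_i^2}$. Then for every $\delta>0$ there exists $\epsilon_0>0$, depending only on $\delta,f,g,m,p,d$, such that for every $0\leq\epsilon\leq\epsilon_0$ there is a set $\Omega=\Omega(\epsilon)\subset[1,2]^d$ with Lebesgue measure $\mathrm{mes}([1,2]^d\setminus\Omega)\leq\delta$ such that for every $\nu\in\Omega$ there exists a real-analytic function $u_\nu\in C^\omega(\mathbb{T}^d,\mathbb{R})$ solving $(\ast)$.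
   Context: The equation $(\ast)$ is obtained by rescaling from $-\Delta u-mu+\epsilon(f u^p+g)=0$ on the rectangular torus $\prod_{i=1}^d(\mathbb{R}/2\pi\beta_i\mathbb{Z})$, $\beta\in[\tfrac12,1]^d$, via $\nu=(\beta_1^{-1},\dots,\beta_d^{-1})$; so the theorem equivalently gives analytic solutions on most rectangular tori. Note the sign convention: with the stated definition of $\Delta_\nu$, the operator $-\Delta_\nu$ acts on $e^{in\cdot x}$ as multiplication by $\sum_i\nu_i^2n_i^2$ (as in the Fourier formulation $(\sum_i\nu_i^2n_i^2-m)\hat u(n)+\epsilon(\widehat{fu^p}+\hat g)(n)=0$, $n\in\mathbb{Z}^d$). *)

theory Defs
  imports "HOL-Analysis.Analysis"
begin

definition freq_dot :: "int ^ 'n::finite \<Rightarrow> real ^ 'n \<Rightarrow> real" where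
  "freq_dot k x = (\<Sum>i\<in>UNIV. of_int (k $ i) * x $ i)"

definition real_trig_poly :: "(real ^ 'n::finite \<Rightarrow> real) \<Rightarrow> bool" where
  "real_trig_poly f \<longleftrightarrow>
     (\<exists>K :: (int ^ 'n) set. \<exists>a b :: int ^ 'n \<Rightarrow> real. finite K \<and>
        f = (\<lambda>x. \<Sum>k\<in>K. a k * cos (freq_dot k x) + b k * sin (freq_dot k x)))"

definition torus_periodic :: "(real ^ 'n::finite \<Rightarrow> real) \<Rightarrow> bool" where
  "torus_periodic u \<longleftrightarrow>
     (\<forall>x i. u (x + (2 * pi) *\<^sub>R axis i 1) = u x)"

text \<open>Real-analyticity at a point: locally the sum of an (unconditionally, hence
  absolutely) convergent multivariate power series.\<close>
definition real_analytic_at :: "(real ^ 'n::finite \<Rightarrow> real) \<Rightarrow> real ^ 'n \<Rightarrow> bool" where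
  "real_analytic_at u x \<longleftrightarrow>
     (\<exists>r > 0. \<exists>c :: ('n \<Rightarrow> nat) \<Rightarrow> real. \<forall>y \<in> ball x r.
        ((\<lambda>\<alpha>. c \<alpha> * (\<Prod>i\<in>UNIV. (y $ i - x $ i) ^ \<alpha> i)) has_sum u y) UNIV)"

definition analytic_on_torus :: "(real ^ 'n::finite \<Rightarrow> real) \<Rightarrow> bool" where
  "analytic_on_torus u \<longleftrightarrow> torus_periodic u \<and> (\<forall>x. real_analytic_at u x)"

text \<open>u solves  -sum_i nu_i^2 d_i^2 u - m u + eps (f u^p + g) = 0 on the torus
  (Fourier form: (sum_i nu_i^2 n_i^2 - m) u_n + eps (f u^p + g)_n = 0).
  D1 i x and D2 i x are the first and second partial derivatives in direction i.\<close>
definition solves_eq ::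
  "real ^ 'n::finite \<Rightarrow> real \<Rightarrow> real \<Rightarrow> nat \<Rightarrow> (real ^ 'n \<Rightarrow> real) \<Rightarrow> (real ^ 'n \<Rightarrow> real)
     \<Rightarrow> (real ^ 'n \<Rightarrow> real) \<Rightarrow> bool" where
  "solves_eq \<nu> m \<epsilon> p f g u \<longleftrightarrow>
     (\<exists>D1 D2 :: 'n \<Rightarrow> real ^ 'n \<Rightarrow> real.
        (\<forall>i x. ((\<lambda>t. u (x + t *\<^sub>R axis i 1)) has_real_derivative D1 i x) (at 0)) \<and>
        (\<forall>i x. ((\<lambda>t. D1 i (x + t *\<^sub>R axis i 1)) has_real_derivative D2 i x) (at 0)) \<and>
        (\<forall>x. - (\<Sum>i\<in>UNIV. (\<nu> $ i)\<^sup>2 * D2 i x) - m * u x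
               + \<epsilon> * (f x * (u x) ^ p + g x) = 0))"

definition param_cube :: "(real ^ 'n::finite) set" where
  "param_cube = {\<nu>. \<forall>i. 1 \<le> \<nu> $ i \<and> \<nu> $ i \<le> 2}"

end

theory Submission
  imports Defs
begin

text \<open>
  The equation is elliptic: in Fourier space the linear part is multiplication by
  \<open>\<Sum>\<^sub>i \<nu>\<^sub>i\<^sup>2 k\<^sub>i\<^sup>2 - m\<close>, which is at least 1 on the whole parameter cube for all but finitely many
  frequencies \<open>k\<close>. For each remaining \<open>k\<close> its zero set is null, so removing a small open
  neighbourhood of these zero sets from the cube leaves a compact set on which all divisors are
  bounded below by some \<open>\<gamma> > 0\<close>. There the linear part has an inverse of norm at most \<open>1 / \<gamma>\<close> on
  trigonometric polynomials normed by \<open>\<Sum>\<^sub>k \<bar>r\<^sub>k\<bar> exp \<bar>k\<bar>\<^sub>1\<close>. This norm is submultiplicative, so for small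
  \<open>\<epsilon>\<close> the Picard iteration converges geometrically. Summability against the exponential weight
  makes the limit analytic.
\<close>

section \<open>Trigonometric polynomials as lists of phase-shifted cosine waves\<close>

type_synonym 'n waves = "((int, 'n) vec \<times> real \<times> real) list"

definition l1 :: "int ^ 'n::finite \<Rightarrow> real" where
  "l1 k = (\<Sum>i\<in>UNIV. \<bar>of_int (k $ i)\<bar>)"

text \<open>The phase lets products, derivatives and sines remain real cosine waves. Frequencies may
  repeat in a list, so addition is plain append. In return \<open>wave_norm\<close> belongs to the
  list and not to the function: it does not see cancellation, so a small difference needs a list
  that is itself small.\<close>

definition wave_sum :: "'n::finite waves \<Rightarrow> real ^ 'n \<Rightarrow> real" where
  "wave_sum ws x = (\<Sum>(k, r, \<theta>)\<leftarrow>ws. r * cos (freq_dot k x + \<theta>))"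

definition wave_norm :: "'n::finite waves \<Rightarrow> real" where
  "wave_norm ws = (\<Sum>(k, r, \<theta>)\<leftarrow>ws. \<bar>r\<bar> * exp (l1 k))"

text \<open>Product-to-sum formula: two cosines multiply to two waves of half the amplitude.\<close>

definition wave_mult :: "'n::finite waves \<Rightarrow> 'n waves \<Rightarrow> 'n waves" where
  "wave_mult ws vs = concat (map (\<lambda>(k, r, \<theta>). concat (map (\<lambda>(l, s, \<eta>).
     [(k + l, r * s / 2, \<theta> + \<eta>), (k - l, r * s / 2, \<theta> - \<eta>)]) vs)) ws)"

definition wave_scale :: "(int ^ 'n \<Rightarrow> real) \<Rightarrow> 'n::finite waves \<Rightarrow> 'n waves" where
  "wave_scale c ws = map (\<lambda>(k, r, \<theta>). (k, c k * r, \<theta>)) ws"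

text \<open>Since \<open>- sin t = cos (t + pi / 2)\<close>, differentiation only shifts the phase
  and rescales the amplitude.\<close>

definition wave_partial :: "'n \<Rightarrow> 'n::finite waves \<Rightarrow> 'n waves" where
  "wave_partial i ws = map (\<lambda>(k, r, \<theta>). (k, of_int (k $ i) * r, \<theta> + pi / 2)) ws"

section \<open>Evaluation rules and submultiplicativity of the weighted norm\<close>

lemma l1_nonneg: "0 \<le> l1 k"
  by (simp add: l1_def sum_nonneg)

lemma abs_component_le_l1: "\<bar>of_int (k $ i)\<bar> \<le> l1 k"
  unfolding l1_def by (rule member_le_sum) auto

lemma l1_add_le: "l1 (k + l) \<le> l1 k + l1 l"
  and l1_diff_le: "l1 (k - l) \<le> l1 k + l1 l"
  unfolding l1_def sum.distrib[symmetric] by (intro sum_mono; simp)+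

lemma freq_dot_add_right: "freq_dot k (x + y) = freq_dot k x + freq_dot k y"
  and freq_dot_add_left: "freq_dot (k + l) x = freq_dot k x + freq_dot l x"
  and freq_dot_diff_left: "freq_dot (k - l) x = freq_dot k x - freq_dot l x"
  by (simp_all add: freq_dot_def algebra_simps sum.distrib sum_subtractf)

lemma freq_dot_scaleR_axis: "freq_dot k (t *\<^sub>R axis i 1) = of_int (k $ i) * t"
  unfolding freq_dot_def axis_def
  by (simp add: if_distrib cong: if_cong)

lemma wave_sum_simps [simp]:
  "wave_sum [] x = 0"
  "wave_sum ((k, r, \<theta>) # ws) x = r * cos (freq_dot k x + \<theta>) + wave_sum ws x"
  "wave_sum (ws @ vs) x = wave_sum ws x + wave_sum vs x"
  by (simp_all add: wave_sum_def)

lemma wave_norm_simps [simp]: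
  "wave_norm [] = 0"
  "wave_norm ((k, r, \<theta>) # ws) = \<bar>r\<bar> * exp (l1 k) + wave_norm ws"
  "wave_norm (ws @ vs) = wave_norm ws + wave_norm vs"
  by (simp_all add: wave_norm_def)

lemma wave_scale_simps [simp]:
  "wave_scale c [] = []"
  "wave_scale c ((k, r, \<theta>) # ws) = (k, c k * r, \<theta>) # wave_scale c ws"
  by (simp_all add: wave_scale_def)

lemma wave_partial_simps [simp]:
  "wave_partial i [] = []"
  "wave_partial i ((k, r, \<theta>) # ws) = (k, of_int (k $ i) * r, \<theta> + pi / 2) # wave_partial i ws"
  by (simp_all add: wave_partial_def)

lemma wave_induct [case_names Nil Cons]:
  assumes "P []" and "\<And>k r \<theta> ws. P ws \<Longrightarrow> P ((k, r, \<theta>) # ws)"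
  shows "P ws"
proof (induction ws)
  case (Cons w ws)
  then show ?case using assms(2) by (cases w) auto
qed (rule assms(1))

lemma wave_norm_nonneg: "0 \<le> wave_norm ws"
  by (induction ws rule: wave_induct) auto

lemma abs_wave_sum_le: "\<bar>wave_sum ws x\<bar> \<le> wave_norm ws"
proof (induction ws rule: wave_induct)
  case (Cons k r \<theta> ws)
  have "\<bar>cos (freq_dot k x + \<theta>)\<bar> \<le> exp (l1 k)"
    using abs_cos_le_one[of "freq_dot k x + \<theta>"] l1_nonneg[of k] by (smt (verit) one_le_exp_iff)
  then have "\<bar>r * cos (freq_dot k x + \<theta>)\<bar> \<le> \<bar>r\<bar> * exp (l1 k)"
    by (simp add: abs_mult mult_left_mono)
  then show ?case using Cons by simp
qed simp

lemma wave_sum_mult_single: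
  fixes vs :: "'n::finite waves"
  shows "wave_sum (concat (map (\<lambda>(l, s, \<eta>).
      [(k + l, r * s / 2, \<theta> + \<eta>), (k - l, r * s / 2, \<theta> - \<eta>)]) vs)) x
    = r * cos (freq_dot k x + \<theta>) * wave_sum vs x"
proof (induction vs rule: wave_induct)
  case (Cons l s \<eta> vs)
  have "cos (freq_dot (k + l) x + (\<theta> + \<eta>)) + cos (freq_dot (k - l) x + (\<theta> - \<eta>))
      = 2 * cos (freq_dot k x + \<theta>) * cos (freq_dot l x + \<eta>)"
    using cos_times_cos[of "freq_dot k x + \<theta>" "freq_dot l x + \<eta>"]
    by (simp add: freq_dot_add_left freq_dot_diff_left algebra_simps)
  then have "r * s / 2 * (cos (freq_dot (k + l) x + (\<theta> + \<eta>)) + cos (freq_dot (k - l) x + (\<theta> - \<eta>)))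
      = r * cos (freq_dot k x + \<theta>) * (s * cos (freq_dot l x + \<eta>))"
    by simp
  then show ?case using Cons by (simp add: algebra_simps)
qed simp

lemma wave_sum_mult: "wave_sum (wave_mult ws vs) x = wave_sum ws x * wave_sum vs x"
  by (induction ws rule: wave_induct)
    (simp_all add: wave_mult_def wave_sum_mult_single distrib_right)

text \<open>Subadditivity of \<open>l1\<close> bounds the weight of each of the two half-amplitude
  waves by the product of the weights of the factors.\<close>

lemma wave_norm_mult_single:
  fixes vs :: "'n::finite waves"
  shows "wave_norm (concat (map (\<lambda>(l, s, \<eta>).
      [(k + l, r * s / 2, \<theta> + \<eta>), (k - l, r * s / 2, \<theta> - \<eta>)]) vs))
    \<le> \<bar>r\<bar> * exp (l1 k) * wave_norm vs"
proof (induction vs rule: wave_induct)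
  case (Cons l s \<eta> vs)
  have "exp (l1 (k + l)) \<le> exp (l1 k) * exp (l1 l)" "exp (l1 (k - l)) \<le> exp (l1 k) * exp (l1 l)"
    unfolding exp_add[symmetric] using l1_add_le l1_diff_le by auto
  then have "\<bar>r * s / 2\<bar> * (exp (l1 (k + l)) + exp (l1 (k - l)))
      \<le> \<bar>r * s / 2\<bar> * (2 * (exp (l1 k) * exp (l1 l)))"
    by (intro mult_left_mono) auto
  also have "\<dots> = \<bar>r\<bar> * exp (l1 k) * (\<bar>s\<bar> * exp (l1 l))"
    by (simp add: abs_mult)
  finally show ?case using Cons by (simp add: algebra_simps)
qed simp

lemma wave_norm_mult: "wave_norm (wave_mult ws vs) \<le> wave_norm ws * wave_norm vs"
proof (induction ws rule: wave_induct)
  case (Cons k r \<theta> ws)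
  then show ?case
    using wave_norm_mult_single[of k r \<theta> vs] by (simp add: wave_mult_def distrib_right)
qed (simp add: wave_mult_def)

lemma wave_norm_scale_le:
  assumes "\<And>k. \<bar>c k\<bar> \<le> C"
  shows "wave_norm (wave_scale c ws) \<le> C * wave_norm ws"
proof (induction ws rule: wave_induct)
  case (Cons k r \<theta> ws)
  have "\<bar>c k\<bar> * (\<bar>r\<bar> * exp (l1 k)) \<le> C * (\<bar>r\<bar> * exp (l1 k))"
    using assms by (intro mult_right_mono) auto
  then show ?case using Cons by (simp add: abs_mult algebra_simps)
qed simp

lemma wave_scale_scale: "wave_scale c (wave_scale d ws) = wave_scale (\<lambda>k. c k * d k) ws"
  by (simp add: wave_scale_def case_prod_unfold o_def mult.assoc)

lemma wave_sum_scale_const: "wave_sum (wave_scale (\<lambda>_. c) ws) x = c * wave_sum ws x"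
  by (induction ws rule: wave_induct) (simp_all add: distrib_left)

section \<open>Derivatives, periodicity, and representation of trigonometric polynomials\<close>

lemma abs_partial_wave_sum_le: "\<bar>wave_sum (wave_partial i ws) x\<bar> \<le> wave_norm ws"
proof (induction ws rule: wave_induct)
  case (Cons k r \<theta> ws)
  let ?c = "cos (freq_dot k x + (\<theta> + pi / 2))"
  have "\<bar>real_of_int (k $ i)\<bar> \<le> exp (l1 k)"
    using abs_component_le_l1[of k i] exp_ge_add_one_self[of "l1 k"] by linarith
  then have "\<bar>real_of_int (k $ i)\<bar> * \<bar>?c\<bar> \<le> exp (l1 k)"
    using mult_mono[OF _ abs_cos_le_one[of "freq_dot k x + (\<theta> + pi / 2)"],
      of "\<bar>real_of_int (k $ i)\<bar>" "exp (l1 k)"] by simp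
  then have "\<bar>r\<bar> * (\<bar>real_of_int (k $ i)\<bar> * \<bar>?c\<bar>) \<le> \<bar>r\<bar> * exp (l1 k)"
    by (intro mult_left_mono) auto
  then have "\<bar>of_int (k $ i) * r * ?c\<bar> \<le> \<bar>r\<bar> * exp (l1 k)"
    by (simp add: abs_mult mult_ac)
  then show ?case using Cons by simp
qed simp

text \<open>The exponential weight pays for the derivatives: \<open>t^2 / 2\<close> is one term of
  the series of \<open>exp t\<close>, whence the constant 2.\<close>

lemma abs_partial2_wave_sum_le:
  "\<bar>wave_sum (wave_partial i (wave_partial i ws)) x\<bar> \<le> 2 * wave_norm ws"
proof (induction ws rule: wave_induct)
  case (Cons k r \<theta> ws)
  let ?c = "cos (freq_dot k x + (\<theta> + pi / 2 + pi / 2))" and ?k = "\<bar>real_of_int (k $ i)\<bar>"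
  have "?k * ?k \<le> l1 k * l1 k"
    using abs_component_le_l1[of k i] by (intro mult_mono) (auto simp: l1_nonneg)
  also have "\<dots> \<le> 2 * exp (l1 k)"
    using exp_lower_Taylor_quadratic[OF l1_nonneg[of k]] l1_nonneg[of k]
    by (simp add: power2_eq_square)
  finally have "?k * ?k * \<bar>?c\<bar> \<le> 2 * exp (l1 k)"
    using mult_mono[OF _ abs_cos_le_one[of "freq_dot k x + (\<theta> + pi / 2 + pi / 2)"],
      of "?k * ?k" "2 * exp (l1 k)"] by simp
  then have "\<bar>r\<bar> * (?k * ?k * \<bar>?c\<bar>) \<le> \<bar>r\<bar> * (2 * exp (l1 k))"
    by (intro mult_left_mono) auto
  then have "\<bar>of_int (k $ i) * (of_int (k $ i) * r) * ?c\<bar> \<le> 2 * (\<bar>r\<bar> * exp (l1 k))"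
    by (simp add: abs_mult mult_ac)
  then show ?case using Cons by simp
qed simp

lemma wave_sum_has_partial_derivative:
  "((\<lambda>t. wave_sum ws (x + t *\<^sub>R axis i 1)) has_real_derivative
     wave_sum (wave_partial i ws) (x + t *\<^sub>R axis i 1)) (at t within T)"
proof (induction ws rule: wave_induct)
  case (Cons k r \<theta> ws)
  have "((\<lambda>t. r * cos (freq_dot k x + of_int (k $ i) * t + \<theta>)) has_real_derivative
      of_int (k $ i) * r * cos (freq_dot k x + of_int (k $ i) * t + (\<theta> + pi / 2))) (at t within T)"
    by (rule derivative_eq_intros refl | simp add: minus_sin_cos_eq add.assoc[symmetric])+
  then show ?case
    unfolding wave_sum_simps wave_partial_simps
    by (intro DERIV_add Cons) (simp add: freq_dot_add_right freq_dot_scaleR_axis)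
qed simp

lemma wave_sum_periodic: "wave_sum ws (x + (2 * pi) *\<^sub>R axis i 1) = wave_sum ws x"
proof (induction ws rule: wave_induct)
  case (Cons k r \<theta> ws)
  have "freq_dot k (x + (2 * pi) *\<^sub>R axis i 1) + \<theta> = freq_dot k x + \<theta> + of_int (k $ i) * (2 * pi)"
    by (simp add: freq_dot_add_right freq_dot_scaleR_axis)
  then have "cos (freq_dot k (x + (2 * pi) *\<^sub>R axis i 1) + \<theta>) = cos (freq_dot k x + \<theta>)"
    using cos.plus_of_int[of "freq_dot k x + \<theta>" "k $ i"] by (simp only: of_real_eq_id id_apply)
  then show ?case using Cons by simp
qed simp

lemma real_trig_poly_wave_sum:
  assumes "real_trig_poly f"
  obtains ws where "f = wave_sum ws"
proof -
  obtain K a b where K: "finite K"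
    and f: "f = (\<lambda>x. \<Sum>k\<in>K. a k * cos (freq_dot k x) + b k * sin (freq_dot k x))"
    using assms unfolding real_trig_poly_def by blast
  obtain ks where ks: "set ks = K" "distinct ks"
    using finite_distinct_list[OF K] by blast
  \<comment> \<open>A sine is a cosine with phase \<open>- (pi / 2)\<close>.\<close>
  define ws where "ws = concat (map (\<lambda>k. [(k, a k, 0), (k, b k, - (pi / 2))]) ks)"
  have "wave_sum ws x = (\<Sum>k\<leftarrow>ks. a k * cos (freq_dot k x) + b k * sin (freq_dot k x))" for x
    unfolding ws_def by (induction ks) (auto simp: cos_diff)
  then have "f = wave_sum ws"
    using ks by (auto simp: f sum_list_distinct_conv_sum_set)
  then show ?thesis by (rule that)
qed

section \<open>Lipschitz bound for the power nonlinearity on the unit ball\<close>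

text \<open>Write \<open>(w + v)^(p+1) - w^(p+1) = (w + v) * ((w + v)^p - w^p) + v * w^p\<close>.
  Both \<open>w + v\<close> and \<open>w^p\<close> have norm at most 1, so each induction step adds
  one more \<open>wave_norm vs\<close>. Appending the two powers with opposite signs would not give
  a bound proportional to \<open>wave_norm vs\<close>.\<close>

lemma wave_power_diff:
  fixes ws vs :: "'n::finite waves"
  assumes "wave_norm ws \<le> 1" "wave_norm (ws @ vs) \<le> 1"
  shows "\<exists>us. (\<forall>x. wave_sum us x = (wave_sum ws x + wave_sum vs x) ^ p - wave_sum ws x ^ p)
    \<and> wave_norm us \<le> real p * wave_norm vs"
proof -
  have pow: "\<exists>qs. (\<forall>x. wave_sum qs x = wave_sum ws x ^ p) \<and> wave_norm qs \<le> 1" for p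
  proof (induction p)
    case 0
    \<comment> \<open>The constant 1 is a wave of frequency 0, whose weight is exactly 1.\<close>
    show ?case by (rule exI[of _ "[(0, 1, 0)]"]) (simp add: freq_dot_def l1_def)
  next
    case (Suc p)
    then obtain qs where "\<forall>x. wave_sum qs x = wave_sum ws x ^ p" "wave_norm qs \<le> 1" by blast
    then show ?case
      using order.trans[OF wave_norm_mult[of ws qs] mult_le_one[OF assms(1) wave_norm_nonneg]]
      by (intro exI[of _ "wave_mult ws qs"]) (auto simp: wave_sum_mult)
  qed
  show ?thesis
  proof (induction p)
    case 0
    show ?case by (rule exI[of _ "[]"]) simp
  next
    case (Suc p)
    then obtain us where us: "\<And>x. wave_sum us x = (wave_sum ws x + wave_sum vs x) ^ p - wave_sum ws x ^ p"
      "wave_norm us \<le> real p * wave_norm vs" by blast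
    obtain qs where qs: "\<And>x. wave_sum qs x = wave_sum ws x ^ p" "wave_norm qs \<le> 1"
      using pow by blast
    have "wave_norm (wave_mult (ws @ vs) us) \<le> 1 * (real p * wave_norm vs)"
      using order.trans[OF wave_norm_mult mult_mono[OF assms(2) us(2)]] wave_norm_nonneg by auto
    moreover have "wave_norm (wave_mult vs qs) \<le> wave_norm vs * 1"
      using order.trans[OF wave_norm_mult mult_left_mono[OF qs(2)]] wave_norm_nonneg by blast
    ultimately have "wave_norm (wave_mult (ws @ vs) us @ wave_mult vs qs) \<le> real (Suc p) * wave_norm vs"
      by (simp add: algebra_simps)
    then show ?case
      by (intro exI[of _ "wave_mult (ws @ vs) us @ wave_mult vs qs"])
        (auto simp: wave_sum_mult us(1) qs(1) algebra_simps)
  qed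
qed

section \<open>The linear part as a Fourier multiplier\<close>

definition symbol :: "real ^ 'n::finite \<Rightarrow> real \<Rightarrow> int ^ 'n \<Rightarrow> real" where
  "symbol \<nu> m k = (\<Sum>i\<in>UNIV. (\<nu> $ i)\<^sup>2 * (of_int (k $ i))\<^sup>2) - m"

text \<open>Two differentiations shift the phase by \<open>pi\<close> and so flip the sign: a wave
  of frequency \<open>k\<close> is an eigenfunction of the linear part with eigenvalue
  \<open>symbol \<nu> m k\<close>.\<close>

lemma wave_sum_symbol:
  "- (\<Sum>i\<in>UNIV. (\<nu> $ i)\<^sup>2 * wave_sum (wave_partial i (wave_partial i ws)) x) - m * wave_sum ws x
     = wave_sum (wave_scale (symbol \<nu> m) ws) x"
proof (induction ws rule: wave_induct)
  case (Cons k r \<theta> ws)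
  let ?c = "cos (freq_dot k x + \<theta>)"
  have c: "cos (freq_dot k x + (\<theta> + pi / 2 + pi / 2)) = - ?c"
    using cos_periodic_pi[of "freq_dot k x + \<theta>"] by (simp add: add.assoc)
  have "(\<Sum>i\<in>UNIV. (\<nu> $ i)\<^sup>2 * (of_int (k $ i) * (of_int (k $ i) * r) * - ?c))
      = - ((symbol \<nu> m k + m) * (r * ?c))"
    unfolding symbol_def diff_add_cancel sum_distrib_right sum_negf[symmetric]
    by (intro sum.cong) (auto simp: power2_eq_square)
  then show ?case
    using Cons by (simp add: c distrib_left sum.distrib) (simp add: algebra_simps)
qed simp

section \<open>Taylor expansion and analyticity of wave series\<close>

text \<open>A finite product of absolutely convergent exponential series multiplies out over all
  multi-indices. Real \<open>z\<close> yields the majorant below, imaginary \<open>z\<close> the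
  Taylor series of a wave.\<close>

lemma has_sum_prod_exp:
  fixes z :: "'n::finite \<Rightarrow> 'a::{banach, real_normed_field}"
  shows "((\<lambda>\<alpha>. \<Prod>i\<in>UNIV. z i ^ \<alpha> i /\<^sub>R fact (\<alpha> i)) has_sum (\<Prod>i\<in>UNIV. exp (z i))) UNIV"
proof -
  have "(\<lambda>n. z i ^ n /\<^sub>R fact n) abs_summable_on UNIV" for i
    by (rule summable_nonneg_imp_summable_on[OF summable_norm_exp]) simp
  moreover have "(\<Sum>\<^sub>\<infinity>n. z i ^ n /\<^sub>R fact n) = exp (z i)" for i
    by (intro infsumI norm_summable_imp_has_sum summable_norm_exp exp_converges)
  ultimately have infsum: "(\<Sum>\<^sub>\<infinity>\<alpha>. \<Prod>i\<in>UNIV. z i ^ \<alpha> i /\<^sub>R fact (\<alpha> i)) = (\<Prod>i\<in>UNIV. exp (z i))"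
    using infsum_prod_PiE_abs[of UNIV "\<lambda>i n. z i ^ n /\<^sub>R fact n" "\<lambda>_. UNIV"] by simp
  have "(\<lambda>\<alpha>. \<Prod>i\<in>UNIV. z i ^ \<alpha> i /\<^sub>R fact (\<alpha> i)) summable_on UNIV"
  proof (rule ccontr)
    \<comment> \<open>A sum that does not converge has the junk value 0, but this one is nonzero.\<close>
    assume "\<not> ?thesis"
    then have "(\<Prod>i\<in>UNIV. exp (z i)) = 0"
      unfolding infsum[symmetric] by (rule infsum_not_exists)
    then show False by simp
  qed
  then show ?thesis
    unfolding infsum[symmetric] by (rule has_sum_infsum)
qed

text \<open>Taylor coefficients at \<open>x\<close>: a wave at \<open>x + h\<close> is the real part
  of \<open>r * cis (freq_dot k x + \<theta>) * cis (freq_dot k h)\<close>, and the last factor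
  splits into one exponential per coordinate.\<close>

definition wave_coeff :: "'n::finite waves \<Rightarrow> real ^ 'n \<Rightarrow> ('n \<Rightarrow> nat) \<Rightarrow> real" where
  "wave_coeff ws x \<alpha> = (\<Sum>(k, r, \<theta>)\<leftarrow>ws. Re (of_real r * cis (freq_dot k x + \<theta>) *
     (\<Prod>i\<in>UNIV. (\<i> * of_int (k $ i)) ^ \<alpha> i /\<^sub>R fact (\<alpha> i))))"

text \<open>Bounds the Taylor coefficients at every base point. As \<open>exp (l1 k)\<close> is the
  product of the exponentials of the \<open>\<bar>k $ i\<bar>\<close>, the sum over all
  multi-indices gives back \<open>wave_norm\<close>.\<close>

definition wave_majorant :: "'n::finite waves \<Rightarrow> ('n \<Rightarrow> nat) \<Rightarrow> real" where
  "wave_majorant ws \<alpha> =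
     (\<Sum>(k, r, \<theta>)\<leftarrow>ws. \<bar>r\<bar> * (\<Prod>i\<in>UNIV. \<bar>of_int (k $ i)\<bar> ^ \<alpha> i /\<^sub>R fact (\<alpha> i)))"

lemma wave_majorant_has_sum: "(wave_majorant ws has_sum wave_norm ws) UNIV"
proof (induction ws rule: wave_induct)
  case Nil
  show ?case by (simp add: wave_majorant_def[abs_def])
next
  case (Cons k r \<theta> ws)
  have "exp (l1 k) = (\<Prod>i\<in>UNIV. exp \<bar>real_of_int (k $ i)\<bar>)"
    by (simp add: l1_def exp_sum)
  then show ?case
    using has_sum_add[OF has_sum_cmult_right[OF has_sum_prod_exp, of "\<bar>r\<bar>"] Cons]
    by (simp add: wave_majorant_def[abs_def])
qed

lemma abs_wave_coeff_le: "\<bar>wave_coeff ws x \<alpha>\<bar> \<le> wave_majorant ws \<alpha>"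
proof (induction ws rule: wave_induct)
  case Nil
  show ?case by (simp add: wave_coeff_def wave_majorant_def)
next
  case (Cons k r \<theta> ws)
  let ?z = "of_real r * cis (freq_dot k x + \<theta>) * (\<Prod>i\<in>UNIV. (\<i> * of_int (k $ i)) ^ \<alpha> i /\<^sub>R fact (\<alpha> i))"
  have "\<bar>Re ?z\<bar> \<le> norm ?z" by (rule abs_Re_le_cmod)
  also have "\<dots> = \<bar>r\<bar> * (\<Prod>i\<in>UNIV. \<bar>of_int (k $ i)\<bar> ^ \<alpha> i /\<^sub>R fact (\<alpha> i))"
    by (simp add: norm_mult norm_power prod_norm[symmetric])
  finally show ?case
    using Cons by (simp add: wave_coeff_def wave_majorant_def)
qed

lemma wave_coeff_has_sum:
  "((\<lambda>\<alpha>. wave_coeff ws x \<alpha> * (\<Prod>i\<in>UNIV. h $ i ^ \<alpha> i)) has_sum wave_sum ws (x + h)) UNIV"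
proof (induction ws rule: wave_induct)
  case Nil
  show ?case by (simp add: wave_coeff_def)
next
  case (Cons k r \<theta> ws)
  let ?a = "of_real r * cis (freq_dot k x + \<theta>)"
  let ?c = "\<lambda>\<alpha>. \<Prod>i\<in>UNIV. (\<i> * of_int (k $ i)) ^ \<alpha> i /\<^sub>R fact (\<alpha> i)"
  have "(\<Prod>i\<in>UNIV. exp (\<i> * of_int (k $ i) * of_real (h $ i))) = cis (freq_dot k h)"
    by (simp add: cis_conv_exp freq_dot_def exp_sum[symmetric] sum_distrib_left mult.assoc)
  then have "((\<lambda>\<alpha>. ?a * (\<Prod>i\<in>UNIV. (\<i> * of_int (k $ i) * of_real (h $ i)) ^ \<alpha> i /\<^sub>R fact (\<alpha> i)))
      has_sum (?a * cis (freq_dot k h))) UNIV"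
    using has_sum_cmult_right[OF has_sum_prod_exp[of "\<lambda>i. \<i> * of_int (k $ i) * complex_of_real (h $ i)"], of ?a]
    by simp
  then have "((\<lambda>\<alpha>. Re (?a * (\<Prod>i\<in>UNIV. (\<i> * of_int (k $ i) * of_real (h $ i)) ^ \<alpha> i /\<^sub>R fact (\<alpha> i))))
      has_sum Re (?a * cis (freq_dot k h))) UNIV"
    by (rule has_sum_Re)
  moreover have "Re (?a * (\<Prod>i\<in>UNIV. (\<i> * of_int (k $ i) * of_real (h $ i)) ^ \<alpha> i /\<^sub>R fact (\<alpha> i)))
      = Re (?a * ?c \<alpha>) * (\<Prod>i\<in>UNIV. h $ i ^ \<alpha> i)" for \<alpha>
  proof -
    have "?a * (\<Prod>i\<in>UNIV. (\<i> * of_int (k $ i) * of_real (h $ i)) ^ \<alpha> i /\<^sub>R fact (\<alpha> i))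
        = of_real (\<Prod>i\<in>UNIV. h $ i ^ \<alpha> i) * (?a * ?c \<alpha>)"
      by (simp add: power_mult_distrib scaleR_conv_of_real prod.distrib mult_ac)
    moreover have "Re (of_real t * z) = Re z * t" for t z by simp
    ultimately show ?thesis by (simp only:)
  qed
  moreover have "Re (?a * cis (freq_dot k h)) = r * cos (freq_dot k (x + h) + \<theta>)"
    unfolding mult.assoc cis_mult by (simp add: freq_dot_add_right add_ac)
  ultimately have "((\<lambda>\<alpha>. Re (?a * ?c \<alpha>) * (\<Prod>i\<in>UNIV. h $ i ^ \<alpha> i))
      has_sum (r * cos (freq_dot k (x + h) + \<theta>))) UNIV"
    by (simp only:)
  from has_sum_add[OF this Cons] show ?case
    by (simp add: wave_coeff_def algebra_simps)
qed

text \<open>For increments with coordinates at most 1 in modulus, the double series over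
  \<open>j\<close> and \<alpha> is dominated by the majorants, whose total is the sum of the norms.
  Hence the order of summation is free: \<alpha> first gives the waves at \<open>y\<close>,
  \<open>j\<close> first gives a single power series about \<open>x\<close>.\<close>

lemma wave_series_real_analytic_at:
  fixes v :: "nat \<Rightarrow> 'n::finite waves"
  assumes "summable (\<lambda>j. wave_norm (v j))"
  shows "real_analytic_at (\<lambda>x. \<Sum>j. wave_sum (v j) x) x"
  unfolding real_analytic_at_def
proof (intro exI conjI ballI)
  let ?M = "\<lambda>(j, \<alpha>). wave_majorant (v j) \<alpha>"
  have maj_nonneg: "0 \<le> wave_majorant (v j) \<alpha>" for j \<alpha>
    using abs_wave_coeff_le[of "v j" x \<alpha>] by linarith
  have maj: "?M summable_on UNIV \<times> UNIV"
  proof (rule summable_on_SigmaI)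
    show "((\<lambda>\<alpha>. ?M (j, \<alpha>)) has_sum wave_norm (v j)) UNIV" for j
      using wave_majorant_has_sum by simp
    show "(\<lambda>j. wave_norm (v j)) summable_on UNIV"
      using assms wave_norm_nonneg by (intro summable_nonneg_imp_summable_on) auto
  qed (use maj_nonneg in auto)
  \<comment> \<open>Chosen before \<open>y\<close>, so that one power series serves the whole ball
    of radius 1.\<close>
  define c where "c \<alpha> = (\<Sum>\<^sub>\<infinity>j. wave_coeff (v j) x \<alpha>)" for \<alpha>
  fix y assume y: "y \<in> ball x 1"
  define h where "h = y - x"
  have "\<bar>h $ i\<bar> \<le> 1" for i
    using y component_le_norm_cart[of h i] by (simp add: h_def dist_norm norm_minus_commute)
  then have h: "\<bar>\<Prod>i\<in>UNIV. h $ i ^ \<alpha> i\<bar> \<le> 1" for \<alpha>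
    by (simp add: abs_prod power_abs power_le_one prod_le_1)
  let ?F = "\<lambda>(j, \<alpha>). wave_coeff (v j) x \<alpha> * (\<Prod>i\<in>UNIV. h $ i ^ \<alpha> i)"
  have "(\<lambda>a. norm (?F a)) summable_on UNIV \<times> UNIV"
  proof (rule summable_on_comparison_test[OF maj])
    fix a :: "nat \<times> ('n \<Rightarrow> nat)"
    show "norm (?F a) \<le> ?M a"
      using mult_mono[OF abs_wave_coeff_le h maj_nonneg]
      by (cases a) (auto simp: abs_mult)
  qed auto
  then obtain S where S: "(?F has_sum S) (UNIV \<times> UNIV)"
    using abs_summable_summable summable_on_def by blast
  have "((\<lambda>j. wave_sum (v j) y) has_sum S) UNIV"
    using has_sum_SigmaD[OF S, of "\<lambda>j. wave_sum (v j) y"] wave_coeff_has_sum[of _ x h] by (simp add: h_def)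
  then have "(\<Sum>j. wave_sum (v j) y) = S"
    using has_sum_imp_sums sums_unique by metis
  moreover have "((\<lambda>\<alpha>. c \<alpha> * (\<Prod>i\<in>UNIV. h $ i ^ \<alpha> i)) has_sum S) UNIV"
  proof (rule has_sum_SigmaD)
    show "((\<lambda>(\<alpha>, j). ?F (j, \<alpha>)) has_sum S) (UNIV \<times> UNIV)"
      using S by (subst (asm) has_sum_swap)
    fix \<alpha>
    have "(\<lambda>j. wave_majorant (v j) \<alpha>) summable_on UNIV"
      using maj summable_on_SigmaD1[of "\<lambda>\<alpha> j. wave_majorant (v j) \<alpha>" UNIV "\<lambda>_. UNIV"]
      by (subst (asm) summable_on_swap) simp
    then have "(\<lambda>j. norm (wave_coeff (v j) x \<alpha>)) summable_on UNIV"
      by (rule summable_on_comparison_test) (auto simp: abs_wave_coeff_le)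
    then have "((\<lambda>j. wave_coeff (v j) x \<alpha>) has_sum c \<alpha>) UNIV"
      unfolding c_def by (rule has_sum_infsum[OF abs_summable_summable])
    then show "((\<lambda>j. case (\<alpha>, j) of (\<alpha>, j) \<Rightarrow> ?F (j, \<alpha>)) has_sum
        (c \<alpha> * (\<Prod>i\<in>UNIV. h $ i ^ \<alpha> i))) UNIV"
      using has_sum_cmult_left by simp
  qed
  ultimately show "((\<lambda>\<alpha>. c \<alpha> * (\<Prod>i\<in>UNIV. (y $ i - x $ i) ^ \<alpha> i)) has_sum
      (\<Sum>j. wave_sum (v j) y)) UNIV"
    by (simp add: h_def)
qed simp

section \<open>Termwise differentiation of wave series\<close>

text \<open>The M-test makes the differentiated series converge uniformly. The majorant
  \<open>M\<close> is left arbitrary so that the lemma applies again to the lists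
  \<open>wave_partial i (v j)\<close> for second derivatives.\<close>

lemma wave_series_has_partial_derivative:
  fixes v :: "nat \<Rightarrow> 'n::finite waves"
  assumes "summable M" "\<And>j x. \<bar>wave_sum (v j) x\<bar> \<le> M j"
    "\<And>j x. \<bar>wave_sum (wave_partial i (v j)) x\<bar> \<le> M j"
  shows "((\<lambda>t. \<Sum>j. wave_sum (v j) (x + t *\<^sub>R axis i 1)) has_real_derivative
    (\<Sum>j. wave_sum (wave_partial i (v j)) x)) (at 0)"
proof -
  have "uniformly_convergent_on UNIV (\<lambda>n t. \<Sum>j<n. wave_sum (wave_partial i (v j)) (x + t *\<^sub>R axis i 1))"
    unfolding uniformly_convergent_on_def
    by (rule exI, rule Weierstrass_m_test[of _ _ M]) (use assms in auto)
  moreover have "summable (\<lambda>j. wave_sum (v j) (x + 0 *\<^sub>R axis i 1))"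
    using assms by (intro summable_comparison_test'[OF assms(1)]) auto
  ultimately have "((\<lambda>t. \<Sum>j. wave_sum (v j) (x + t *\<^sub>R axis i 1)) has_real_derivative
    (\<Sum>j. wave_sum (wave_partial i (v j)) (x + 0 *\<^sub>R axis i 1))) (at 0)"
    by (intro has_field_derivative_series'(2)[of UNIV _ _ 0] wave_sum_has_partial_derivative) auto
  then show ?thesis by simp
qed

section \<open>Nonresonant parameters\<close>

text \<open>With a diagonal map \<open>A\<close> the symbol is
  \<open>(norm (A \<nu>))^2 - m\<close>, so its sublevel set at 0 is convex, and the frontier of a
  convex set is null. Frequencies with vanishing components need no separate treatment.\<close>

lemma negligible_symbol_zero:
  assumes "m > 0"
  shows "negligible {\<nu> :: real ^ 'n::finite. symbol \<nu> m k = 0}"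
proof -
  define A :: "real ^ 'n \<Rightarrow> real ^ 'n" where "A \<nu> = (\<chi> i. of_int (k $ i) * \<nu> $ i)" for \<nu>
  have A: "linear A"
    by (rule linearI) (auto simp: A_def vec_eq_iff algebra_simps)
  have symbol: "symbol \<nu> m k = (norm (A \<nu>))\<^sup>2 - m" for \<nu>
    by (simp add: symbol_def A_def norm_vec_def L2_set_def sum_nonneg power_mult_distrib mult.commute)
  define S where "S = A -` cball 0 (sqrt m)"
  have S: "\<nu> \<in> S \<longleftrightarrow> symbol \<nu> m k \<le> 0" for \<nu>
    using real_sqrt_le_iff[of "(norm (A \<nu>))\<^sup>2" m] by (simp add: S_def symbol)
  have "convex S"
    unfolding S_def by (intro convex_linear_vimage A) simp
  \<comment> \<open>The resonant set is the boundary of a (possibly degenerate) ellipsoid, hence null.\<close>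
  have "\<nu> \<in> frontier S" if \<nu>: "symbol \<nu> m k = 0" for \<nu>
  proof -
    \<comment> \<open>An interior point could be dilated by some \<open>t > 1\<close> without
      leaving \<open>S\<close>, but there the symbol is \<open>(t^2 - 1) * m > 0\<close>.\<close>
    have "\<nu> \<notin> interior S"
    proof
      assume "\<nu> \<in> interior S"
      moreover have "((\<lambda>t. t *\<^sub>R \<nu>) \<longlongrightarrow> 1 *\<^sub>R \<nu>) (at_right (1::real))"
        by (intro tendsto_intros)
      ultimately have "eventually (\<lambda>t. t *\<^sub>R \<nu> \<in> interior S) (at_right (1::real))"
        using topological_tendstoD[OF _ open_interior] by simp
      then have "eventually (\<lambda>t. t *\<^sub>R \<nu> \<in> interior S \<and> t > 1) (at_right (1::real))"
        by (intro eventually_conj eventually_at_right_less)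
      then obtain t :: real where t: "t *\<^sub>R \<nu> \<in> S" "t > 1"
        using eventually_happens'[OF trivial_limit_at_right_real] interior_subset by blast
      have "symbol (t *\<^sub>R \<nu>) m k = t\<^sup>2 * m - m"
        using \<nu> by (simp add: symbol linear_scale[OF A] power_mult_distrib)
      moreover have "t\<^sup>2 * m > 1 * m"
        using t assms by (intro mult_strict_right_mono) auto
      ultimately show False using t S by simp
    qed
    then show ?thesis
      using S[of \<nu>] \<nu> closure_subset unfolding frontier_def by auto
  qed
  then show ?thesis
    using negligible_convex_frontier[OF \<open>convex S\<close>] by (auto intro: negligible_subset)
qed

lemma finite_int_vec_sum_squares_le:
  "finite {k :: int ^ 'n::finite. (\<Sum>i\<in>UNIV. (real_of_int (k $ i))\<^sup>2) \<le> c}"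
proof (rule finite_subset)
  let ?I = "{- \<lceil>c\<rceil>..\<lceil>c\<rceil>}"
  show "finite (vec_lambda ` (PiE UNIV (\<lambda>_. ?I)) :: (int ^ 'n) set)"
    by (intro finite_imageI finite_PiE) auto
  show "{k :: int ^ 'n. (\<Sum>i\<in>UNIV. (real_of_int (k $ i))\<^sup>2) \<le> c} \<subseteq> vec_lambda ` (PiE UNIV (\<lambda>_. ?I))"
  proof
    fix k :: "int ^ 'n"
    assume k: "k \<in> {k. (\<Sum>i\<in>UNIV. (real_of_int (k $ i))\<^sup>2) \<le> c}"
    have "\<bar>k $ i\<bar> \<le> \<lceil>c\<rceil>" for i
    proof -
      have "\<bar>k $ i\<bar> \<le> (k $ i)\<^sup>2"
        by (metis abs_le_square_iff power2_abs self_le_power abs_ge_zero zero_less_numeral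
            int_one_le_iff_zero_less zero_less_abs_iff order_le_less power_zero_numeral abs_zero)
      then have "real_of_int \<bar>k $ i\<bar> \<le> (real_of_int (k $ i))\<^sup>2"
        by (metis of_int_le_iff of_int_power)
      also have "\<dots> \<le> (\<Sum>i\<in>UNIV. (real_of_int (k $ i))\<^sup>2)"
        by (rule member_le_sum) auto
      also have "\<dots> \<le> c" using k by simp
      finally show ?thesis by linarith
    qed
    then have "k = vec_lambda (vec_nth k)" "vec_nth k \<in> PiE UNIV (\<lambda>_. ?I)"
      by (auto simp: abs_le_iff minus_le_iff)
    then show "k \<in> vec_lambda ` (PiE UNIV (\<lambda>_. ?I))" by blast
  qed
qed

lemma compact_param_cube: "compact (param_cube :: (real ^ 'n::finite) set)"
proof -
  have "param_cube = cbox (vec 1) (vec 2 :: real ^ 'n)"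
    by (auto simp: param_cube_def mem_box_cart)
  then show ?thesis by (metis compact_cbox)
qed

lemma nonresonant_set:
  assumes "m > 0" "\<delta> > 0"
  obtains \<Omega> :: "(real ^ 'n::finite) set" and \<gamma> :: real
  where "\<Omega> \<subseteq> param_cube" "\<Omega> \<in> sets lebesgue" "emeasure lebesgue (param_cube - \<Omega>) \<le> ennreal \<delta>"
    "\<gamma> > 0" "\<And>\<nu> k. \<nu> \<in> \<Omega> \<Longrightarrow> \<gamma> \<le> \<bar>symbol \<nu> m k\<bar>"
proof -
  \<comment> \<open>On the cube each squared parameter is at least 1, so the threshold
    \<open>m + 1\<close> makes the symbol exceed 1 for all frequencies outside
    \<open>K\<close>.\<close>
  define K where "K = {k :: int ^ 'n. (\<Sum>i\<in>UNIV. (real_of_int (k $ i))\<^sup>2) \<le> m + 1}"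
  define Z where "Z = (\<Union>k\<in>K. {\<nu> :: real ^ 'n. symbol \<nu> m k = 0})"
  have "finite K" unfolding K_def by (rule finite_int_vec_sum_squares_le)
  then have "negligible Z"
    unfolding Z_def using negligible_symbol_zero[OF assms(1)] by (intro negligible_Union) auto
  then have Z: "Z \<in> null_sets lebesgue" by (simp add: negligible_iff_null_sets)
  \<comment> \<open>Outer regularity; as \<open>Z\<close> is null, \<open>U\<close> itself has
    measure below \<delta>.\<close>
  then obtain U where U: "open U" "Z \<subseteq> U" "U - Z \<in> lmeasurable" "emeasure lebesgue (U - Z) < ennreal \<delta>"
    using sets_lebesgue_outer_open[of Z \<delta>] assms(2) by blast
  define \<Omega> where "\<Omega> = param_cube - U"
  have "compact \<Omega>"
    unfolding \<Omega>_def by (rule compact_diff[OF compact_param_cube U(1)])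
  have "\<exists>\<gamma> > 0. \<forall>\<nu>\<in>\<Omega>. \<gamma> \<le> \<bar>symbol \<nu> m k\<bar>" if "k \<in> K" for k
  \<comment> \<open>For large \<delta> the set \<Omega> may be empty; no minimum is attained then,
    but any positive number is a lower bound.\<close>
  proof (cases "\<Omega> = {}")
    case False
    have "continuous_on \<Omega> (\<lambda>\<nu>. \<bar>symbol \<nu> m k\<bar>)"
      unfolding symbol_def by (intro continuous_intros)
    from continuous_attains_inf[OF \<open>compact \<Omega>\<close> False this]
    obtain \<nu> where \<nu>: "\<nu> \<in> \<Omega>" "\<forall>\<mu>\<in>\<Omega>. \<bar>symbol \<nu> m k\<bar> \<le> \<bar>symbol \<mu> m k\<bar>" by blast
    moreover have "symbol \<nu> m k \<noteq> 0"
      using \<nu>(1) U(2) \<open>k \<in> K\<close> by (auto simp: \<Omega>_def Z_def)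
    ultimately show ?thesis by (intro exI[of _ "\<bar>symbol \<nu> m k\<bar>"]) auto
  qed (use gt_ex in auto)
  then obtain \<gamma>' where \<gamma>': "\<And>k. k \<in> K \<Longrightarrow> \<gamma>' k > 0"
    "\<And>k \<nu>. k \<in> K \<Longrightarrow> \<nu> \<in> \<Omega> \<Longrightarrow> \<gamma>' k \<le> \<bar>symbol \<nu> m k\<bar>" by metis
  \<comment> \<open>The entry 1 covers the frequencies outside \<open>K\<close>.\<close>
  define \<gamma> :: real where "\<gamma> = Min (insert 1 (\<gamma>' ` K))"
  have \<gamma>: "\<gamma> \<le> 1" "\<And>k. k \<in> K \<Longrightarrow> \<gamma> \<le> \<gamma>' k" "\<gamma> > 0"
    using \<open>finite K\<close> \<gamma>'(1) by (auto simp: \<gamma>_def)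
  show ?thesis
  proof (rule that)
    show "\<Omega> \<subseteq> param_cube" by (auto simp: \<Omega>_def)
    show "\<Omega> \<in> sets lebesgue"
      using \<open>compact \<Omega>\<close> by (simp add: lmeasurable_compact fmeasurableD)
    have "U \<in> sets lebesgue" using U(1) by simp
    then have "emeasure lebesgue (param_cube - \<Omega>) \<le> emeasure lebesgue U"
      by (intro emeasure_mono) (auto simp: \<Omega>_def)
    also have "\<dots> = emeasure lebesgue (U - Z)"
      using Z \<open>U \<in> sets lebesgue\<close> by (simp add: emeasure_Diff_null_set)
    finally show "emeasure lebesgue (param_cube - \<Omega>) \<le> ennreal \<delta>"
      using U(4) by simp
    show "\<gamma> > 0" by (rule \<gamma>)
    fix \<nu> k assume \<nu>: "\<nu> \<in> \<Omega>"
    show "\<gamma> \<le> \<bar>symbol \<nu> m k\<bar>"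
    proof (cases "k \<in> K")
      case True
      then show ?thesis using \<gamma>(2) \<gamma>'(2)[OF True \<nu>] by force
    next
      case False
      have "1 \<le> (\<nu> $ i)\<^sup>2" for i
        using \<nu> by (auto simp: \<Omega>_def param_cube_def)
      then have "(\<Sum>i\<in>UNIV. (real_of_int (k $ i))\<^sup>2) \<le> (\<Sum>i\<in>UNIV. (\<nu> $ i)\<^sup>2 * (of_int (k $ i))\<^sup>2)"
        by (intro sum_mono) (simp add: mult_le_cancel_right1)
      then show ?thesis using False \<gamma>(1) by (simp add: K_def symbol_def)
    qed
  qed
qed

section \<open>Picard iteration\<close>

text \<open>The iteration produces corrections, each represented by its own small list, and the
  solution is their sum. \<open>g_small\<close> makes the first correction at most 1/2 in norm;
  \<open>f_small\<close>, which contains the Lipschitz constant \<open>p\<close>, halves the norm at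
  each later step.\<close>

lemma solution_exists:
  fixes fs gs :: "'n::finite waves"
  assumes \<gamma>: "\<gamma> > 0" "\<And>k. \<gamma> \<le> \<bar>symbol \<nu> m k\<bar>" and "0 \<le> \<epsilon>" and "p > 0"
    and f_small: "\<epsilon> * (wave_norm fs * real p) \<le> \<gamma> / 2" and g_small: "\<epsilon> * wave_norm gs \<le> \<gamma> / 2"
  shows "\<exists>u. analytic_on_torus u \<and> solves_eq \<nu> m \<epsilon> p (wave_sum fs) (wave_sum gs) u"
proof -
  let ?L = "\<lambda>w. wave_sum (wave_scale (symbol \<nu> m) w)"
  have inverse: "\<exists>w. (\<forall>x. ?L w x = - \<epsilon> * wave_sum us x) \<and> wave_norm w \<le> \<epsilon> * wave_norm us / \<gamma>" for us
  proof (intro exI conjI allI)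
    let ?w = "wave_scale (\<lambda>k. - \<epsilon> / symbol \<nu> m k) us"
    have "symbol \<nu> m k \<noteq> 0" for k using \<gamma>(1) \<gamma>(2)[of k] by auto
    then show "?L ?w x = - \<epsilon> * wave_sum us x" for x
      by (simp add: wave_scale_scale wave_sum_scale_const[of "- \<epsilon>", simplified])
    have "\<bar>- \<epsilon> / symbol \<nu> m k\<bar> \<le> \<epsilon> / \<gamma>" for k
      using \<gamma>(1) \<gamma>(2)[of k] \<open>0 \<le> \<epsilon>\<close> by (simp add: abs_divide frac_le)
    from wave_norm_scale_le[OF this] show "wave_norm ?w \<le> \<epsilon> * wave_norm us / \<gamma>" by simp
  qed
  \<comment> \<open>In a state \<open>s\<close>, \<open>fst s\<close> is the current approximation and \<open>snd s\<close> the next correction.\<close>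
  define P where "P j s \<longleftrightarrow> wave_norm (fst s) \<le> 1 - (1/2) ^ j \<and> wave_norm (snd s) \<le> (1/2) ^ Suc j \<and>
    (j = 0 \<longrightarrow> fst s = [] \<and> (\<forall>x. ?L (snd s) x = - \<epsilon> * wave_sum gs x))"
    for j :: nat and s :: "'n waves \<times> 'n waves"
  \<comment> \<open>The new correction compensates the change in the nonlinear term caused by the
    previous one.\<close>
  define Q where "Q s s' \<longleftrightarrow> fst s' = fst s @ snd s \<and> (\<forall>x. ?L (snd s') x = - \<epsilon> * (wave_sum fs x *
    (wave_sum (fst s') x ^ p - wave_sum (fst s) x ^ p)))" for s s' :: "'n waves \<times> 'n waves"
  have "\<exists>s. P 0 s"
  proof -
    obtain w where w: "\<And>x. ?L w x = - \<epsilon> * wave_sum gs x" "wave_norm w \<le> \<epsilon> * wave_norm gs / \<gamma>"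
      using inverse by blast
    have "\<epsilon> * wave_norm gs / \<gamma> \<le> 1 / 2"
      using g_small \<gamma>(1) by (simp add: field_simps)
    with w(2) have "wave_norm w \<le> 1 / 2" by (rule order.trans)
    then show ?thesis
      using w(1) by (intro exI[of _ "([], w)"]) (simp add: P_def)
  qed
  moreover have "\<exists>s'. P (Suc j) s' \<and> Q s s'" if "P j s" for j s
  proof -
    have n: "wave_norm (fst s) \<le> 1 - (1/2) ^ j" "wave_norm (snd s) \<le> (1/2) ^ Suc j"
      using that by (auto simp: P_def)
    have pos: "(1/2 :: real) ^ Suc j > 0" by simp
    \<comment> \<open>The geometric bounds on the corrections add up to
      \<open>1 - (1/2) ^ Suc j\<close>, so every approximation stays in the unit ball, as
      \<open>wave_power_diff\<close> requires.\<close>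
    have n': "wave_norm (fst s @ snd s) \<le> 1 - (1/2) ^ Suc j"
      using n by simp
    have "wave_norm (fst s) \<le> 1" "wave_norm (fst s @ snd s) \<le> 1"
      using n n' pos wave_norm_nonneg[of "snd s"] by (simp_all only: wave_norm_simps)
    from wave_power_diff[OF this, of p] obtain us where us:
      "\<And>x. wave_sum us x = (wave_sum (fst s) x + wave_sum (snd s) x) ^ p - wave_sum (fst s) x ^ p"
      "wave_norm us \<le> real p * wave_norm (snd s)" by blast
    obtain w where w: "\<And>x. ?L w x = - \<epsilon> * wave_sum (wave_mult fs us) x"
      "wave_norm w \<le> \<epsilon> * wave_norm (wave_mult fs us) / \<gamma>"
      using inverse by blast
    have "\<epsilon> * wave_norm (wave_mult fs us) \<le> \<epsilon> * (wave_norm fs * (real p * wave_norm (snd s)))"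
      using order.trans[OF wave_norm_mult mult_left_mono[OF us(2) wave_norm_nonneg]] \<open>0 \<le> \<epsilon>\<close>
      by (intro mult_left_mono) auto
    also have "\<dots> = \<epsilon> * (wave_norm fs * real p) * wave_norm (snd s)" by simp
    also have "\<dots> \<le> \<gamma> / 2 * wave_norm (snd s)"
      by (intro mult_right_mono f_small wave_norm_nonneg)
    finally have "\<epsilon> * wave_norm (wave_mult fs us) / \<gamma> \<le> wave_norm (snd s) / 2"
      using \<gamma>(1) by (simp add: field_simps)
    with w(2) have "wave_norm w \<le> wave_norm (snd s) / 2" by (rule order.trans)
    then have "wave_norm w \<le> (1/2) ^ Suc (Suc j)"
      using n(2) by simp
    then show ?thesis
      using w(1) us(1) n' by (intro exI[of _ "(fst s @ snd s, w)"]) (auto simp: P_def Q_def wave_sum_mult)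
  qed
  \<comment> \<open>Dependent choice. \<open>Q\<close> only relates consecutive states, so the
    initial condition is carried by the clause of \<open>P\<close> for \<open>j = 0\<close>.\<close>
  ultimately obtain s where s: "\<And>j. P j (s j)" "\<And>j. Q (s j) (s (Suc j))"
    using dependent_nat_choice[of P "\<lambda>_. Q"] by blast
  define v where "v j = snd (s j)" for j
  have norm_v: "wave_norm (v j) \<le> (1/2) ^ Suc j" for j
    using s(1)[of j] by (simp add: P_def v_def)
  have sum_v: "summable (\<lambda>j. wave_norm (v j))"
  proof (rule summable_comparison_test')
    show "summable (\<lambda>j. (1/2 :: real) ^ Suc j)" by (simp add: summable_geometric)
    show "norm (wave_norm (v j)) \<le> (1/2) ^ Suc j" if "j \<ge> 0" for j
      using norm_v[of j] wave_norm_nonneg[of "v j"] by simp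
  qed
  \<comment> \<open>One majorant for the series and both of its derivatives; the factor 2 comes from
    the second derivative.\<close>
  define M where "M j = 2 * wave_norm (v j)" for j
  have sum_M: "summable M" unfolding M_def by (intro summable_mult sum_v)
  have bounds: "\<bar>wave_sum (v j) x\<bar> \<le> M j" "\<bar>wave_sum (wave_partial i (v j)) x\<bar> \<le> M j"
    "\<bar>wave_sum (wave_partial i (wave_partial i (v j))) x\<bar> \<le> M j" for i j x
    using abs_wave_sum_le[of "v j" x] abs_partial_wave_sum_le[of i "v j" x]
      abs_partial2_wave_sum_le[of i "v j" x] wave_norm_nonneg[of "v j"]
    unfolding M_def by linarith+
  have summable: "summable (\<lambda>j. wave_sum (v j) x)"
    "summable (\<lambda>j. wave_sum (wave_partial i (wave_partial i (v j))) x)" for i x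
    by (rule summable_comparison_test'[OF sum_M], simp add: bounds)+
  define u where "u x = (\<Sum>j. wave_sum (v j) x)" for x
  define D where "D i x = (\<Sum>j. wave_sum (wave_partial i (wave_partial i (v j))) x)" for i x
  have partial_sums: "wave_sum (fst (s j)) x = (\<Sum>i<j. wave_sum (v i) x)" for j x
  proof (induction j)
    case 0
    show ?case using s(1)[of 0] by (simp add: P_def)
  next
    case (Suc j)
    then show ?case using s(2)[of j] by (simp add: Q_def v_def)
  qed
  have equation: "- (\<Sum>i\<in>UNIV. (\<nu> $ i)\<^sup>2 * D i x) - m * u x
      + \<epsilon> * (wave_sum fs x * u x ^ p + wave_sum gs x) = 0" for x
  proof -
    have "(\<lambda>j. ?L (v j) x) sums (- (\<Sum>i\<in>UNIV. (\<nu> $ i)\<^sup>2 * D i x) - m * u x)"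
      unfolding wave_sum_symbol[symmetric] D_def u_def
      by (intro sums_diff sums_minus sums_sum sums_mult summable_sums summable)
    then have "(\<lambda>n. \<Sum>j<Suc n. ?L (v j) x) \<longlonglongrightarrow> - (\<Sum>i\<in>UNIV. (\<nu> $ i)\<^sup>2 * D i x) - m * u x"
      unfolding sums_def by (rule LIMSEQ_Suc)
    \<comment> \<open>Telescoping with a shift: the linear part of the sum up to \<open>v n\<close>
      meets the nonlinear term at the approximation without \<open>v n\<close>. Both approximations
      have the same limit, which therefore solves the equation.\<close>
    moreover have "(\<Sum>j<Suc n. ?L (v j) x)
        = - \<epsilon> * (wave_sum fs x * wave_sum (fst (s n)) x ^ p + wave_sum gs x)" for n
    proof (induction n)
      case 0
      \<comment> \<open>The initial approximation vanishes and \<open>0 ^ p = 0\<close> for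
        \<open>p > 0\<close>, so only the \<open>gs\<close> term remains.\<close>
      show ?case using s(1)[of 0] \<open>p > 0\<close> by (simp add: P_def v_def)
    next
      case (Suc n)
      have "?L (v (Suc n)) x = - \<epsilon> * (wave_sum fs x *
          (wave_sum (fst (s (Suc n))) x ^ p - wave_sum (fst (s n)) x ^ p))"
        using s(2)[of n] by (simp only: Q_def v_def)
      then show ?case using Suc by (simp add: algebra_simps)
    qed
    moreover have "(\<lambda>n. wave_sum (fst (s n)) x) \<longlonglongrightarrow> u x"
      unfolding partial_sums u_def by (intro summable_LIMSEQ summable)
    then have "(\<lambda>n. - \<epsilon> * (wave_sum fs x * wave_sum (fst (s n)) x ^ p + wave_sum gs x))
        \<longlonglongrightarrow> - \<epsilon> * (wave_sum fs x * u x ^ p + wave_sum gs x)"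
      by (intro tendsto_intros)
    ultimately have "- (\<Sum>i\<in>UNIV. (\<nu> $ i)\<^sup>2 * D i x) - m * u x
        = - \<epsilon> * (wave_sum fs x * u x ^ p + wave_sum gs x)"
      using LIMSEQ_unique by simp
    then show ?thesis by simp
  qed
  have "analytic_on_torus u"
    unfolding analytic_on_torus_def torus_periodic_def u_def
    by (intro conjI allI wave_series_real_analytic_at[OF sum_v]) (simp add: wave_sum_periodic)
  moreover have "solves_eq \<nu> m \<epsilon> p (wave_sum fs) (wave_sum gs) u"
    unfolding solves_eq_def
  proof (intro exI conjI allI)
    let ?D1 = "\<lambda>i x. \<Sum>j. wave_sum (wave_partial i (v j)) x"
    show "((\<lambda>t. u (x + t *\<^sub>R axis i 1)) has_real_derivative ?D1 i x) (at 0)" for i x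
      unfolding u_def by (rule wave_series_has_partial_derivative[OF sum_M]) (rule bounds)+
    show "((\<lambda>t. ?D1 i (x + t *\<^sub>R axis i 1)) has_real_derivative D i x) (at 0)" for i x
      unfolding D_def by (rule wave_series_has_partial_derivative[OF sum_M]) (rule bounds)+
  qed (rule equation)
  ultimately show ?thesis by blast
qed

theorem theorem1p1:
  fixes f g :: "real ^ 'n::finite \<Rightarrow> real" and m :: real and p :: nat
  assumes "p \<ge> 2" and "m > 0"
    and "real_trig_poly f" and "real_trig_poly g" and "g \<noteq> (\<lambda>x. 0)"
  shows "\<forall>\<delta> > 0. \<exists>\<epsilon>0 > 0. \<forall>\<epsilon>. 0 \<le> \<epsilon> \<and> \<epsilon> \<le> \<epsilon>0 \<longrightarrow>
           (\<exists>\<Omega> \<subseteq> (param_cube :: (real ^ 'n) set). \<Omega> \<in> sets lebesgue \<and>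
              emeasure lebesgue (param_cube - \<Omega>) \<le> ennreal \<delta> \<and>
              (\<forall>\<nu> \<in> \<Omega>. \<exists>u. analytic_on_torus u \<and> solves_eq \<nu> m \<epsilon> p f g u))"
proof (intro allI impI)
  fix \<delta> :: real assume "\<delta> > 0"
  obtain fs gs where fg: "f = wave_sum fs" "g = wave_sum gs"
    using real_trig_poly_wave_sum assms(3,4) by metis
  \<comment> \<open>Fixed before \<epsilon>: the same set and the same \<gamma> serve every
    \<epsilon> up to the threshold.\<close>
  obtain \<Omega> :: "(real ^ 'n) set" and \<gamma> :: real
    where \<Omega>: "\<Omega> \<subseteq> param_cube" "\<Omega> \<in> sets lebesgue" "emeasure lebesgue (param_cube - \<Omega>) \<le> ennreal \<delta>"
      "\<gamma> > 0" "\<And>\<nu> k. \<nu> \<in> \<Omega> \<Longrightarrow> \<gamma> \<le> \<bar>symbol \<nu> m k\<bar>"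
    using nonresonant_set[OF \<open>m > 0\<close> \<open>\<delta> > 0\<close>] by metis
  \<comment> \<open>The summand 1 keeps the denominator below positive; the other two yield the
    smallness conditions of \<open>solution_exists\<close>.\<close>
  let ?C = "1 + wave_norm fs * real p + wave_norm gs"
  have nonneg: "wave_norm fs * real p \<ge> 0" "wave_norm gs \<ge> 0"
    by (simp_all add: wave_norm_nonneg)
  show "\<exists>\<epsilon>0 > 0. \<forall>\<epsilon>. 0 \<le> \<epsilon> \<and> \<epsilon> \<le> \<epsilon>0 \<longrightarrow>
           (\<exists>\<Omega> \<subseteq> (param_cube :: (real ^ 'n) set). \<Omega> \<in> sets lebesgue \<and>
              emeasure lebesgue (param_cube - \<Omega>) \<le> ennreal \<delta> \<and>
              (\<forall>\<nu> \<in> \<Omega>. \<exists>u. analytic_on_torus u \<and> solves_eq \<nu> m \<epsilon> p f g u))"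
  proof (intro exI[of _ "\<gamma> / (2 * ?C)"] conjI allI impI)
    show "\<gamma> / (2 * ?C) > 0" using nonneg \<Omega>(4) by simp
    fix \<epsilon> assume \<epsilon>: "0 \<le> \<epsilon> \<and> \<epsilon> \<le> \<gamma> / (2 * ?C)"
    have C: "\<epsilon> * ?C \<le> \<gamma> / 2"
      using \<epsilon> nonneg by (simp add: field_simps)
    have "\<epsilon> * (wave_norm fs * real p) \<le> \<epsilon> * ?C" "\<epsilon> * wave_norm gs \<le> \<epsilon> * ?C"
      using \<epsilon> nonneg by (intro mult_left_mono; simp)+
    then have "\<exists>u. analytic_on_torus u \<and> solves_eq \<nu> m \<epsilon> p f g u" if "\<nu> \<in> \<Omega>" for \<nu>
      unfolding fg using \<Omega>(4,5) that \<epsilon> C \<open>p \<ge> 2\<close> by (intro solution_exists[of \<gamma>]) auto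
    then show "\<exists>\<Omega> \<subseteq> (param_cube :: (real ^ 'n) set). \<Omega> \<in> sets lebesgue \<and>
              emeasure lebesgue (param_cube - \<Omega>) \<le> ennreal \<delta> \<and>
              (\<forall>\<nu> \<in> \<Omega>. \<exists>u. analytic_on_torus u \<and> solves_eq \<nu> m \<epsilon> p f g u)"
      using \<Omega> by blast
  qed
qed

end
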